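(* For every integer $k$ and every $k$-tree $G$, we have $\mathrm{dim}_{cb}(G)\le \mathrm{dim}^{ext}_{cb}(G)\le k+1$.
   Context: A box is an axis-aligned box in $\mathbb{R}^d$ (Cartesian product of closed intervals of non-zero length); $B[i]$ denotes the projection of a box $B$ to the $i$-th coordinate. $B_1\sqsubseteq B_2$ means $B_2$ contains a translate of $B_1$; boxes are comparable if one is $\sqsubseteq$ the other. A touching representation of $G$ by boxes is a map $h$ from $V(G)$ to boxes such that distinct vertices get boxes with disjoint interiors, and $h(u)\cap h(v)\ne\emptyset$ iff $uv\in E(G)$; it is by comparable boxes if all pairs of boxes are comparable. $\mathrm{dim}_{cb}(G)$ is the least $d$ such that $G$ has a touching representation by comparable boxes in $\mathbb{R}^d$. Clique-sum extendability: let $G$ have a distinguished clique $C^\star$ (possibly empty, denoted $\emptyset$). A touching representation $h$ of $G$ by boxes in $\mathbb{R}^d$ is $C^\star$-clique-sum extendable if, for every sufficiently small $\varepsilon>0$: (vertices) for each $u\in V(C^\star)$ there is a dimension $d_u$ with (v0) $d_u\neq d_{u'}$ for distinct $u,u'\in V(C^\star)$, (v1) $h(u)[d_u]=[-1,0]$ and $h(u)[i]=[0,1]$ for all $i\neq d_u$, and (v2) every $v\notin V(C^\star)$ satisfies $h(v)\subset[0,1)^d$; (cliques) for every clique $C$ of $G$ there is a point $p(C)\in[0,1)^d\cap\bigcap_{v\in V(C)}h(v)$ such that, defining the box $h^\varepsilon(C)$ by $h^\varepsilon(C)[i]=[p(C)[i],p(C)[i]+\varepsilon]$ for all $i$: (c1)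 $h^\varepsilon(C_1)\cap h^\varepsilon(C_2)=\emptyset$ for distinct cliques $C_1,C_2$; (c2) $h(v)$ intersects $h^\varepsilon(C)$ iff $v\in V(C)$, and in that case there is a dimension $i_{C,v}$ such that $h(v)[j]\cap h^\varepsilon(C)[j]=\{p(C)[i_{C,v}]\}$ if $j=i_{C,v}$ and $=[p(C)[j],p(C)[j]+\varepsilon]$ otherwise. $\mathrm{dim}^{ext}_{cb}(G)$ is the least $d$ such that $G$ has an $\emptyset$-clique-sum extendable touching representation by comparable boxes in $\mathbb{R}^d$. A full clique-sum of graphs $G_1,G_2$ is obtained from their disjoint union by identifying the vertices of a clique in $G_1$ with those of a clique of the same size in $G_2$ (keeping all edges). A $k$-tree is any graph obtained by repeated full clique-sums on cliques of size $k$ from cliques of size at most $k+1$. *)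

theory Defs
  imports "HOL-Analysis.Analysis" "HOL-Library.Ramsey" "HOL-Library.Extended_Nat"
begin

section \<open>Graphs, full clique-sums and \<open>k\<close>-trees\<close>

record 'a sgraph =
  verts :: "'a set"
  edges :: "'a set set"

definition cliques :: "'a sgraph \<Rightarrow> 'a set set" where
  "cliques G = {C. C \<subseteq> verts G \<and> clique C (edges G)}"

definition complete_sgraph :: "'a set \<Rightarrow> 'a sgraph" where
  "complete_sgraph V = \<lparr>verts = V, edges = [V]\<^bsup>2\<^esup>\<rparr>"

text \<open>
  \<open>G\<close> is, up to isomorphism, the disjoint union of \<open>G1\<close> and \<open>G2\<close> with a clique \<open>C1\<close> of \<open>G1\<close>
  and a clique \<open>C2\<close> of \<open>G2\<close>, both of size \<open>k\<close>, identified. The maps \<open>f1\<close> and \<open>f2\<close> send the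
  vertices of \<open>G1\<close> and \<open>G2\<close> to the corresponding vertices of \<open>G\<close>, so that \<open>u \<in> C1\<close> and
  \<open>w \<in> C2\<close> are identified iff \<open>f1 u = f2 w\<close>.
\<close>

definition full_clique_sum :: "nat \<Rightarrow> 'a sgraph \<Rightarrow> 'b sgraph \<Rightarrow> 'c sgraph \<Rightarrow> bool" where
  "full_clique_sum k G1 G2 G \<longleftrightarrow>
     (\<exists>C1 C2 f1 f2.
        C1 \<in> cliques G1 \<and> finite C1 \<and> card C1 = k \<and>
        C2 \<in> cliques G2 \<and> finite C2 \<and> card C2 = k \<and>
        inj_on f1 (verts G1) \<and> inj_on f2 (verts G2) \<and>
        f1 ` C1 = f2 ` C2 \<and> f1 ` verts G1 \<inter> f2 ` verts G2 = f1 ` C1 \<and>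
        verts G = f1 ` verts G1 \<union> f2 ` verts G2 \<and>
        edges G = (\<lambda>e. f1 ` e) ` edges G1 \<union> (\<lambda>e. f2 ` e) ` edges G2)"

inductive k_tree :: "nat \<Rightarrow> 'a sgraph \<Rightarrow> bool" for k where
  base: "finite V \<Longrightarrow> card V \<le> k + 1 \<Longrightarrow> k_tree k (complete_sgraph V)"
| sum: "k_tree k G1 \<Longrightarrow> k_tree k G2 \<Longrightarrow> full_clique_sum k G1 G2 G \<Longrightarrow> k_tree k G"

section \<open>Touching representations by comparable boxes\<close>

text \<open>
  The dimension \<open>d\<close> varies inside the definitions below, so \<open>\<real>\<^sup>d\<close> is the library's
  \<open>Euclidean_space d\<close>, whose points are the \<open>x :: nat \<Rightarrow> real\<close> with \<open>x i = 0\<close> for \<open>i \<ge> d\<close>;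
  the coordinates are indexed by \<open>0, \<dots>, d - 1\<close>.
\<close>

definition closed_box :: "nat \<Rightarrow> (nat \<Rightarrow> real) \<Rightarrow> (nat \<Rightarrow> real) \<Rightarrow> (nat \<Rightarrow> real) set" where
  "closed_box d a b = {x \<in> topspace (Euclidean_space d). \<forall>i<d. x i \<in> {a i..b i}}"

definition is_box :: "nat \<Rightarrow> (nat \<Rightarrow> real) set \<Rightarrow> bool" where
  "is_box d B \<longleftrightarrow> (\<exists>a b. (\<forall>i<d. a i < b i) \<and> B = closed_box d a b)"

definition coord :: "(nat \<Rightarrow> real) set \<Rightarrow> nat \<Rightarrow> real set" where
  "coord B i = (\<lambda>x. x i) ` B"

definition box_le :: "nat \<Rightarrow> (nat \<Rightarrow> real) set \<Rightarrow> (nat \<Rightarrow> real) set \<Rightarrow> bool" where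
  "box_le d B1 B2 \<longleftrightarrow> (\<exists>t \<in> topspace (Euclidean_space d). (\<lambda>x i. x i + t i) ` B1 \<subseteq> B2)"

definition comparable :: "nat \<Rightarrow> (nat \<Rightarrow> real) set \<Rightarrow> (nat \<Rightarrow> real) set \<Rightarrow> bool" where
  "comparable d B1 B2 \<longleftrightarrow> box_le d B1 B2 \<or> box_le d B2 B1"

definition touching_rep :: "nat \<Rightarrow> 'a sgraph \<Rightarrow> ('a \<Rightarrow> (nat \<Rightarrow> real) set) \<Rightarrow> bool" where
  "touching_rep d G h \<longleftrightarrow>
     (\<forall>v\<in>verts G. is_box d (h v)) \<and>
     (\<forall>u\<in>verts G. \<forall>v\<in>verts G. u \<noteq> v \<longrightarrow>
        Euclidean_space d interior_of h u \<inter> Euclidean_space d interior_of h v = {} \<and>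
        (h u \<inter> h v \<noteq> {} \<longleftrightarrow> {u, v} \<in> edges G))"

definition by_comparable_boxes :: "nat \<Rightarrow> 'a sgraph \<Rightarrow> ('a \<Rightarrow> (nat \<Rightarrow> real) set) \<Rightarrow> bool" where
  "by_comparable_boxes d G h \<longleftrightarrow> (\<forall>u\<in>verts G. \<forall>v\<in>verts G. comparable d (h u) (h v))"

text \<open>The infimum of the empty set is \<open>\<infinity>\<close>; otherwise it is the least element.\<close>

definition dim_cb :: "'a sgraph \<Rightarrow> enat" where
  "dim_cb G = Inf {enat d |d. \<exists>h. touching_rep d G h \<and> by_comparable_boxes d G h}"

section \<open>Clique-sum extendability\<close>

definition unit_cube :: "nat \<Rightarrow> (nat \<Rightarrow> real) set" where
  "unit_cube d = {x \<in> topspace (Euclidean_space d). \<forall>i<d. x i \<in> {0..<1}}"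

definition eps_box :: "nat \<Rightarrow> real \<Rightarrow> (nat \<Rightarrow> real) \<Rightarrow> (nat \<Rightarrow> real) set" where
  "eps_box d \<epsilon> q = closed_box d q (\<lambda>i. q i + \<epsilon>)"

definition vertices_condition ::
  "nat \<Rightarrow> 'a sgraph \<Rightarrow> 'a set \<Rightarrow> ('a \<Rightarrow> (nat \<Rightarrow> real) set) \<Rightarrow> bool" where
  "vertices_condition d G Cstar h \<longleftrightarrow>
     (\<exists>dm :: 'a \<Rightarrow> nat.
        dm ` Cstar \<subseteq> {..<d} \<and> inj_on dm Cstar \<and>
        (\<forall>u\<in>Cstar. \<forall>i<d. coord (h u) i = (if i = dm u then {-1..0} else {0..1}))) \<and>
     (\<forall>v\<in>verts G - Cstar. h v \<subseteq> unit_cube d)"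

text \<open>The empty clique is included: \<open>p {}\<close> lies in the unit cube and its \<open>\<epsilon>\<close>-box avoids all \<open>h v\<close>.\<close>

definition cliques_condition ::
  "nat \<Rightarrow> 'a sgraph \<Rightarrow> ('a \<Rightarrow> (nat \<Rightarrow> real) set) \<Rightarrow> real \<Rightarrow> bool" where
  "cliques_condition d G h \<epsilon> \<longleftrightarrow>
     (\<exists>p :: 'a set \<Rightarrow> nat \<Rightarrow> real.
        (\<forall>C\<in>cliques G. p C \<in> unit_cube d \<and> (\<forall>v\<in>C. p C \<in> h v)) \<and>
        (\<forall>C1\<in>cliques G. \<forall>C2\<in>cliques G. C1 \<noteq> C2 \<longrightarrow>
           eps_box d \<epsilon> (p C1) \<inter> eps_box d \<epsilon> (p C2) = {}) \<and>
        (\<forall>C\<in>cliques G. \<forall>v\<in>verts G.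
           (h v \<inter> eps_box d \<epsilon> (p C) \<noteq> {} \<longleftrightarrow> v \<in> C) \<and>
           (v \<in> C \<longrightarrow>
              (\<exists>i<d. \<forall>j<d. coord (h v) j \<inter> coord (eps_box d \<epsilon> (p C)) j =
                 (if j = i then {p C i} else {p C j..p C j + \<epsilon>})))))"

definition clique_sum_extendable ::
  "nat \<Rightarrow> 'a sgraph \<Rightarrow> 'a set \<Rightarrow> ('a \<Rightarrow> (nat \<Rightarrow> real) set) \<Rightarrow> bool" where
  "clique_sum_extendable d G Cstar h \<longleftrightarrow>
     touching_rep d G h \<and> Cstar \<in> cliques G \<and>
     (\<forall>\<^sub>F \<epsilon> in at_right 0. vertices_condition d G Cstar h \<and> cliques_condition d G h \<epsilon>)"

definition dim_cb_ext :: "'a sgraph \<Rightarrow> enat" where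
  "dim_cb_ext G =
     Inf {enat d |d. \<exists>h. clique_sum_extendable d G {} h \<and> by_comparable_boxes d G h}"

end

theory Submission
  imports Defs
begin

text \<open>
  Every \<open>k\<close>-tree arises from any one of its cliques by repeatedly adding a vertex whose
  neighbourhood is a clique of size at most \<open>k\<close>. Such a sequence, started at the empty clique, is
  realised by hypercubes in \<open>\<real>\<^sup>k\<^sup>+\<^sup>1\<close>: each clique \<open>C\<close> owns a private small cube with lowest corner
  \<open>q C\<close> which touches every \<open>h u\<close>, \<open>u \<in> C\<close>, from above in direction \<open>dir C u\<close>, and different
  vertices use different directions. A new vertex with neighbourhood \<open>C\<close> becomes the lower half of
  that private cube. As \<open>card C \<le> k\<close>, some direction \<open>m\<close> is still free; the new cliques get points on
  the upper facet of the new cube in direction \<open>m\<close>, and \<open>q C\<close> is moved beyond that facet.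
\<close>

section \<open>Building \<open>k\<close>-trees vertex by vertex\<close>

definition add_vertex :: "'a sgraph \<Rightarrow> 'a \<Rightarrow> 'a set \<Rightarrow> 'a sgraph" where
  "add_vertex G v C =
     \<lparr>verts = insert v (verts G), edges = edges G \<union> (\<lambda>u. {u, v}) ` C\<rparr>"

text \<open>The starting graph is a parameter so that a growth sequence can be replayed on top of
  another graph that already contains the starting clique.\<close>

inductive grows :: "nat \<Rightarrow> 'a sgraph \<Rightarrow> 'a sgraph \<Rightarrow> bool" for k G0 where
  refl: "grows k G0 G0"
| add: "grows k G0 G \<Longrightarrow> C \<in> cliques G \<Longrightarrow> finite C \<Longrightarrow> card C \<le> k \<Longrightarrow> v \<notin> verts G \<Longrightarrow>
    grows k G0 (add_vertex G v C)"

text \<open>\<open>H\<close> stays as it is and only \<open>G\<close> is renamed by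
  \<open>f\<close>; vertices whose images already lie in \<open>H\<close> are thereby identified
  with them.\<close>

definition glue :: "('a \<Rightarrow> 'b) \<Rightarrow> 'b sgraph \<Rightarrow> 'a sgraph \<Rightarrow> 'b sgraph" where
  "glue f H G = \<lparr>verts = verts H \<union> f ` verts G, edges = edges H \<union> (`) f ` edges G\<rparr>"

section \<open>Cliques and growth under gluing\<close>

lemma cliquesD:
  assumes "C \<in> cliques G"
  shows "C \<subseteq> verts G" and "\<And>u v. u \<in> C \<Longrightarrow> v \<in> C \<Longrightarrow> u \<noteq> v \<Longrightarrow> {u, v} \<in> edges G"
  using assms by (auto simp: cliques_def clique_def)

lemma cliquesI:
  assumes "C \<subseteq> verts G" and "\<And>u v. u \<in> C \<Longrightarrow> v \<in> C \<Longrightarrow> u \<noteq> v \<Longrightarrow> {u, v} \<in> edges G"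
  shows "C \<in> cliques G"
  using assms by (auto simp: cliques_def clique_def)

lemma image_mem_cliques_glue:
  assumes "C \<in> cliques G"
  shows "f ` C \<in> cliques (glue f H G)"
proof (rule cliquesI)
  show "f ` C \<subseteq> verts (glue f H G)"
    using cliquesD(1)[OF assms] by (auto simp: glue_def)
next
  fix x y assume "x \<in> f ` C" "y \<in> f ` C" "x \<noteq> y"
  then obtain u v where uv: "u \<in> C" "v \<in> C" "x = f u" "y = f v" "u \<noteq> v" by blast
  then have "f ` {u, v} \<in> (`) f ` edges G" using cliquesD(2)[OF assms] by blast
  then show "{x, y} \<in> edges (glue f H G)" using uv by (simp add: glue_def)
qed

lemma glue_complete_sgraph:
  assumes "f ` C \<in> cliques H" "inj_on f C"
  shows "glue f H (complete_sgraph C) = H"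
proof -
  have "f ` e \<in> edges H" if "e \<in> [C]\<^bsup>2\<^esup>" for e
  proof -
    from that obtain x y where "e = {x, y}" "x \<noteq> y" "x \<in> C" "y \<in> C"
      by (auto simp: nsets_def card_2_iff)
    then show ?thesis
      using cliquesD(2)[OF assms(1), of "f x" "f y"] inj_onD[OF assms(2), of x y] by auto
  qed
  then show ?thesis
    using cliquesD(1)[OF assms(1)] by (cases H) (auto simp: glue_def complete_sgraph_def)
qed

lemma glue_add_vertex: "glue f H (add_vertex G v C) = add_vertex (glue f H G) (f v) (f ` C)"
  by (auto simp: glue_def add_vertex_def image_Un image_image)

lemma verts_mono_grows: "grows k G0 G \<Longrightarrow> verts G0 \<subseteq> verts G"
  by (induction rule: grows.induct) (auto simp: add_vertex_def)

text \<open>Gluing commutes with \<open>add_vertex\<close>, so the sequence that builds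
  \<open>G\<close> from \<open>C\<close> replays on top of \<open>H\<close>. Injectivity and the
  intersection hypothesis keep each added vertex outside the graph built so far.\<close>

lemma grows_glue:
  assumes "grows k (complete_sgraph C) G" "inj_on f (verts G)"
    and "f ` C \<in> cliques H" "verts H \<inter> f ` verts G = f ` C"
  shows "grows k H (glue f H G)"
  using assms
proof (induction rule: grows.induct)
  case refl
  then have "inj_on f C" by (simp add: complete_sgraph_def)
  with refl show ?case by (simp add: glue_complete_sgraph grows.refl)
next
  case (add G D v)
  let ?G = "add_vertex G v D"
  have "C \<subseteq> verts G"
    using verts_mono_grows[OF add.hyps(1)] by (simp add: complete_sgraph_def)
  have sub: "verts ?G = insert v (verts G)" by (simp add: add_vertex_def)
  have inj: "inj_on f (verts G)"
    using add.prems(1) by (simp add: sub)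
  have vG: "f v \<notin> f ` verts G"
    using add.prems(1) add.hyps(5) by (simp add: sub)
  have int: "verts H \<inter> f ` verts G = f ` C"
    using add.prems(3) \<open>C \<subseteq> verts G\<close> by (auto simp: sub)
  have "f v \<notin> verts H"
  proof
    assume "f v \<in> verts H"
    then have "f v \<in> f ` C" using add.prems(3) sub by blast
    then show False using vG \<open>C \<subseteq> verts G\<close> by blast
  qed
  then have "f v \<notin> verts (glue f H G)" using vG by (simp add: glue_def)
  moreover have "card (f ` D) \<le> k"
    using card_image_le[OF add.hyps(3), of f] add.hyps(4) by linarith
  ultimately show ?case
    unfolding glue_add_vertex using add.hyps(2,3)
    by (intro grows.add add.IH[OF inj add.prems(2) int]) (simp_all add: image_mem_cliques_glue)
qed

lemma grows_trans: "grows k G1 G2 \<Longrightarrow> grows k G0 G1 \<Longrightarrow> grows k G0 G2"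
  by (induction rule: grows.induct) (auto intro: grows.add)

section \<open>Growing a k-tree from any of its cliques\<close>

lemma k_tree_wellformed:
  assumes "k_tree k G"
  shows "finite (verts G) \<and> \<Union> (edges G) \<subseteq> verts G"
  using assms
proof (induction rule: k_tree.induct)
  case (base V)
  then show ?case by (auto simp: complete_sgraph_def nsets_def)
next
  case (sum G1 G2 G)
  then show ?case unfolding full_clique_sum_def by fastforce
qed

text \<open>The remaining vertices are added one by one, each joined to all earlier ones. At most
  \<open>k\<close> vertices precede each addition because \<open>V\<close> has at most
  \<open>k + 1\<close>.\<close>

lemma complete_sgraph_grows:
  assumes "finite V" "card V \<le> k + 1" "C \<subseteq> V"
  shows "grows k (complete_sgraph C) (complete_sgraph V)"
proof -
  have "grows k (complete_sgraph C) (complete_sgraph (C \<union> W))"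
    if "finite W" "W \<subseteq> V - C" for W
    using that
  proof (induction W rule: finite_induct)
    case empty
    then show ?case by (simp add: grows.refl)
  next
    case (insert v W)
    let ?D = "C \<union> W"
    have fin: "finite ?D" using assms(1,3) insert.hyps(1) finite_subset by auto
    have "v \<notin> ?D" using insert by auto
    have "card (insert v ?D) \<le> card V"
      using assms insert.prems by (intro card_mono) auto
    then have "card ?D \<le> k" using fin \<open>v \<notin> ?D\<close> assms(2) by simp
    moreover have "complete_sgraph (C \<union> insert v W) = add_vertex (complete_sgraph ?D) v ?D"
      using \<open>v \<notin> ?D\<close>
      by (auto simp: complete_sgraph_def add_vertex_def nsets_def card_2_iff doubleton_eq_iff
          image_iff)
    moreover have "?D \<in> cliques (complete_sgraph ?D)"
      by (rule cliquesI) (auto simp: complete_sgraph_def nsets_def)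
    ultimately show ?case
      using insert fin \<open>v \<notin> ?D\<close> by (auto intro!: grows.add simp: complete_sgraph_def)
  qed
  from this[of "V - C"] show ?thesis
    using assms by (simp add: Un_absorb1 finite_subset)
qed

text \<open>First \<open>G1\<close> is grown from the preimage of \<open>C\<close>, then
  \<open>G2\<close> is grown from \<open>C2\<close> on top of the copy of \<open>G1\<close>. Only
  cliques on the \<open>G1\<close> side are treated; the other side follows by exchanging the
  roles.\<close>

lemma glued_clique_grows:
  assumes C1: "C1 \<in> cliques G1" and C2: "C2 \<in> cliques G2"
    and inj: "inj_on f1 (verts G1)" "inj_on f2 (verts G2)"
    and im: "f1 ` C1 = f2 ` C2" "f1 ` verts G1 \<inter> f2 ` verts G2 = f1 ` C1"
    and G: "verts G = f1 ` verts G1 \<union> f2 ` verts G2"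
      "edges G = (`) f1 ` edges G1 \<union> (`) f2 ` edges G2"
    and wf: "\<Union> (edges G1) \<subseteq> verts G1" "\<Union> (edges G2) \<subseteq> verts G2"
    and gr1: "\<And>C. C \<in> cliques G1 \<Longrightarrow> grows k (complete_sgraph C) G1"
    and gr2: "\<And>C. C \<in> cliques G2 \<Longrightarrow> grows k (complete_sgraph C) G2"
    and C: "C \<in> cliques G" "C \<subseteq> f1 ` verts G1"
  shows "grows k (complete_sgraph C) G"
proof -
  define C' where "C' = {x \<in> verts G1. f1 x \<in> C}"
  have fC': "f1 ` C' = C" using C(2) by (auto simp: C'_def)
  have C': "C' \<in> cliques G1"
  proof (rule cliquesI)
    fix x y assume xy: "x \<in> C'" "y \<in> C'" "x \<noteq> y"
    then have V: "x \<in> verts G1" "y \<in> verts G1" by (auto simp: C'_def)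
    have "f1 x \<noteq> f1 y" using V xy(3) inj(1) by (auto dest: inj_onD)
    then have "{f1 x, f1 y} \<in> edges G" using cliquesD(2)[OF C(1)] xy by (auto simp: C'_def)
    then consider "{f1 x, f1 y} \<in> (`) f1 ` edges G1" | "{f1 x, f1 y} \<in> (`) f2 ` edges G2"
      unfolding G(2) by (meson UnE)
    then show "{x, y} \<in> edges G1"
    proof cases
      case 1
      then obtain e where e: "{f1 x, f1 y} = f1 ` e" "e \<in> edges G1" by (rule imageE)
      then have "f1 ` {x, y} = f1 ` e" "e \<subseteq> verts G1" using wf(1) by auto
      then have "{x, y} = e" using V inj_on_image_eq_iff[OF inj(1), of "{x, y}" e] by simp
      then show ?thesis using e(2) by simp
    next
      \<comment> \<open>An edge that stems from \<open>G2\<close> has both ends in the identified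
        clique, so \<open>x\<close> and \<open>y\<close> are adjacent in \<open>G1\<close> as
        well.\<close>
      case 2
      then obtain e where e: "{f1 x, f1 y} = f2 ` e" "e \<in> edges G2" by (rule imageE)
      then have "{f1 x, f1 y} \<subseteq> f2 ` verts G2" using wf(2) by (simp add: Sup_le_iff image_mono)
      then have "f1 x \<in> f2 ` verts G2" "f1 y \<in> f2 ` verts G2" by simp_all
      then have "f1 x \<in> f1 ` C1" "f1 y \<in> f1 ` C1" using im(2) V by blast+
      then have "x \<in> C1" "y \<in> C1"
        using inj(1) V cliquesD(1)[OF C1] by (auto simp: inj_on_image_mem_iff)
      then show ?thesis using cliquesD(2)[OF C1] xy(3) by blast
    qed
  qed (auto simp: C'_def)
  \<comment> \<open>\<open>H\<close> is the copy of \<open>G1\<close> inside \<open>G\<close>,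
    written so that \<open>grows_glue\<close> applies with the complete graph on \<open>C\<close> as
    its base.\<close>
  define H where "H = glue f1 (complete_sgraph C) G1"
  have "C \<in> cliques (complete_sgraph C)"
    by (rule cliquesI) (auto simp: complete_sgraph_def)
  then have "grows k (complete_sgraph C) H"
    unfolding H_def using C(2) fC'
    by (intro grows_glue[OF gr1[OF C'] inj(1)]) (auto simp: complete_sgraph_def)
  moreover have "grows k H (glue f2 H G2)"
  proof (rule grows_glue[OF gr2[OF C2] inj(2)])
    show "f2 ` C2 \<in> cliques H"
      unfolding H_def im(1)[symmetric] by (rule image_mem_cliques_glue[OF C1])
    show "verts H \<inter> f2 ` verts G2 = f2 ` C2"
      using im C(2) by (auto simp: H_def glue_def complete_sgraph_def)
  qed
  moreover have "glue f2 H G2 = G"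
  proof -
    have "[C]\<^bsup>2\<^esup> \<subseteq> edges G" using cliquesD(2)[OF C(1)] by (auto elim!: nsets2_E)
    then show ?thesis
      using C(2) G by (cases G) (auto simp: H_def glue_def complete_sgraph_def)
  qed
  ultimately show ?thesis using grows_trans by fastforce
qed

text \<open>The induction covers all cliques at once: in a clique-sum, one of the two graphs has to
  be grown from the identified clique, whatever clique the growth of \<open>G\<close> starts
  from.\<close>

lemma k_tree_grows:
  assumes "k_tree k G" "C \<in> cliques G"
  shows "grows k (complete_sgraph C) G"
  using assms
proof (induction arbitrary: C rule: k_tree.induct)
  case (base V)
  then have "C \<subseteq> V" using cliquesD(1)[OF base.prems] by (simp add: complete_sgraph_def)
  with base.hyps show ?case by (rule complete_sgraph_grows)
next
  case (sum G1 G2 G)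
  note wf = k_tree_wellformed[OF sum.hyps(1), THEN conjunct2]
    k_tree_wellformed[OF sum.hyps(2), THEN conjunct2]
  obtain C1 C2 f1 f2 where
    CC: "C1 \<in> cliques G1" "C2 \<in> cliques G2" "inj_on f1 (verts G1)" "inj_on f2 (verts G2)"
    and im: "f1 ` C1 = f2 ` C2" "f1 ` verts G1 \<inter> f2 ` verts G2 = f1 ` C1"
    and G: "verts G = f1 ` verts G1 \<union> f2 ` verts G2"
      "edges G = (`) f1 ` edges G1 \<union> (`) f2 ` edges G2"
    using sum.hyps(3) unfolding full_clique_sum_def by (elim exE conjE) (rule that)
  \<comment> \<open>A clique cannot straddle the sum: two vertices, one missing from each side, are
    joined by no edge of either graph.\<close>
  have "C \<subseteq> f1 ` verts G1 \<or> C \<subseteq> f2 ` verts G2"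
  proof (rule ccontr)
    assume "\<not> ?thesis"
    then obtain x y where xy: "x \<in> C" "x \<notin> f1 ` verts G1" "y \<in> C" "y \<notin> f2 ` verts G2" by blast
    then have "x \<noteq> y" using cliquesD(1)[OF sum.prems] G(1) by blast
    then have "{x, y} \<in> edges G" using cliquesD(2)[OF sum.prems] xy by blast
    then consider "{x, y} \<in> (`) f1 ` edges G1" | "{x, y} \<in> (`) f2 ` edges G2"
      unfolding G(2) by (meson UnE)
    then show False
    proof cases
      case 1
      then obtain e where "{x, y} = f1 ` e" "e \<in> edges G1" by (rule imageE)
      then have "{x, y} \<subseteq> f1 ` verts G1" using wf(1) by (simp add: Sup_le_iff image_mono)
      then show False using xy by simp
    next
      case 2
      then obtain e where "{x, y} = f2 ` e" "e \<in> edges G2" by (rule imageE)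
      then have "{x, y} \<subseteq> f2 ` verts G2" using wf(2) by (simp add: Sup_le_iff image_mono)
      then show False using xy by simp
    qed
  qed
  then show ?case
  proof
    assume "C \<subseteq> f1 ` verts G1"
    then show ?thesis
      using glued_clique_grows[OF CC im G wf sum.IH sum.prems] by blast
  next
    assume "C \<subseteq> f2 ` verts G2"
    moreover have "f2 ` verts G2 \<inter> f1 ` verts G1 = f2 ` C2" using im by blast
    moreover have "verts G = f2 ` verts G2 \<union> f1 ` verts G1"
      "edges G = (`) f2 ` edges G2 \<union> (`) f1 ` edges G1" using G by auto
    ultimately show ?thesis
      using glued_clique_grows[OF CC(2,1,4,3) im(1)[symmetric] _ _ _ wf(2,1) sum.IH(2,1) sum.prems]
      by blast
  qed
qed

section \<open>Hypercube representations\<close>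

text \<open>
  The vertex \<open>v\<close> is represented by the cube with lowest corner \<open>a v\<close> and side \<open>s v\<close>. A single
  \<open>\<epsilon>\<close> works for the clique points \<open>q C\<close>, and hence so does every smaller one.
\<close>

locale cube_rep =
  fixes d :: nat and G :: "'a sgraph" and a :: "'a \<Rightarrow> nat \<Rightarrow> real" and s :: "'a \<Rightarrow> real"
    and q :: "'a set \<Rightarrow> nat \<Rightarrow> real" and dir :: "'a set \<Rightarrow> 'a \<Rightarrow> nat" and \<epsilon> :: real
  assumes edges_wf: "\<Union> (edges G) \<subseteq> verts G"
    and eps_pos: "0 < \<epsilon>"
    and side_pos: "v \<in> verts G \<Longrightarrow> 0 < s v"
    and cube_in: "v \<in> verts G \<Longrightarrow> i < d \<Longrightarrow> 0 \<le> a v i \<and> a v i + s v < 1"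
    and non_overlap: "u \<in> verts G \<Longrightarrow> v \<in> verts G \<Longrightarrow> u \<noteq> v \<Longrightarrow>
      \<exists>i<d. a u i + s u \<le> a v i \<or> a v i + s v \<le> a u i"
    and touch_iff: "u \<in> verts G \<Longrightarrow> v \<in> verts G \<Longrightarrow> u \<noteq> v \<Longrightarrow>
      {u, v} \<in> edges G \<longleftrightarrow> (\<forall>i<d. a u i \<le> a v i + s v \<and> a v i \<le> a u i + s u)"
    and point_in: "C \<in> cliques G \<Longrightarrow> i < d \<Longrightarrow> 0 \<le> q C i \<and> q C i + \<epsilon> < 1"
    and points_apart: "C \<in> cliques G \<Longrightarrow> D \<in> cliques G \<Longrightarrow> C \<noteq> D \<Longrightarrow>
      \<exists>i<d. q C i + \<epsilon> < q D i \<or> q D i + \<epsilon> < q C i"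
    and point_off: "C \<in> cliques G \<Longrightarrow> v \<in> verts G \<Longrightarrow> v \<notin> C \<Longrightarrow>
      \<exists>i<d. q C i + \<epsilon> < a v i \<or> a v i + s v < q C i"
    and dir_less: "C \<in> cliques G \<Longrightarrow> v \<in> C \<Longrightarrow> dir C v < d"
    and point_facet: "C \<in> cliques G \<Longrightarrow> v \<in> C \<Longrightarrow> q C (dir C v) = a v (dir C v) + s v"
    and point_side: "C \<in> cliques G \<Longrightarrow> v \<in> C \<Longrightarrow> i < d \<Longrightarrow> i \<noteq> dir C v \<Longrightarrow>
      a v i \<le> q C i \<and> q C i + \<epsilon> \<le> a v i + s v"
    and inj_dir: "C \<in> cliques G \<Longrightarrow> inj_on (dir C) C"

text \<open>The empty clique is the only clique here, and its private cube is
  \<open>[0, 1/2]\<close> in every coordinate.\<close>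

lemma cube_rep_empty:
  "0 < d \<Longrightarrow> cube_rep d (complete_sgraph {}) (\<lambda>_ _. 0) (\<lambda>_. 1) (\<lambda>_ _. 0) (\<lambda>_ _. 0) (1/2)"
  by unfold_locales (auto simp: complete_sgraph_def cliques_def nsets_def)

text \<open>All neighbours of \<open>v\<close> lie in \<open>C\<close>, and every new edge contains
  \<open>v\<close>.\<close>

lemma cliques_add_vertexD:
  assumes "D \<in> cliques (add_vertex G v C)" "C \<in> cliques G" "v \<notin> verts G" "\<Union> (edges G) \<subseteq> verts G"
  shows "if v \<in> D then D - {v} \<subseteq> C else D \<in> cliques G"
proof (cases "v \<in> D")
  case True
  have "u \<in> C" if "u \<in> D" "u \<noteq> v" for u
  proof -
    have "{u, v} \<in> edges (add_vertex G v C)" using cliquesD(2)[OF assms(1)] that True by blast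
    then have "{u, v} \<in> edges G \<or> u \<in> C" using that by (auto simp: add_vertex_def doubleton_eq_iff)
    then show ?thesis using assms(3,4) by blast
  qed
  then show ?thesis using True by auto
next
  case False
  have "D \<in> cliques G"
  proof (rule cliquesI)
    show "D \<subseteq> verts G" using False cliquesD(1)[OF assms(1)] by (auto simp: add_vertex_def)
    fix x y assume xy: "x \<in> D" "y \<in> D" "x \<noteq> y"
    then have "{x, y} \<in> edges (add_vertex G v C)" using cliquesD(2)[OF assms(1)] by blast
    moreover have "v \<notin> {x, y}" using xy False by auto
    ultimately show "{x, y} \<in> edges G" by (auto simp: add_vertex_def)
  qed
  then show ?thesis using False by simp
qed

section \<open>Adding a vertex to a cube representation\<close>

context cube_rep
begin

text \<open>Every new private cube is placed inside an old one: that of \<open>C\<close> for cliques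
  through \<open>v\<close>, that of the clique itself otherwise. All old separations therefore
  survive, and new ones are needed only inside the private cube of \<open>C\<close>.\<close>

lemma cube_rep_add_vertex:
  assumes C: "C \<in> cliques G" "finite C" "card C < d" and v: "v \<notin> verts G"
  shows "\<exists>a' s' q' dir' \<epsilon>'. cube_rep d (add_vertex G v C) a' s' q' dir' \<epsilon>'"
proof -
  \<comment> \<open>The vertices of \<open>C\<close> occupy fewer than \<open>d\<close> directions;
    a free one is reserved for \<open>v\<close>.\<close>
  have "\<exists>m<d. m \<notin> dir C ` C"
  proof (rule ccontr)
    assume "\<not> ?thesis"
    then have "{..<d} \<subseteq> dir C ` C" by auto
    then have "card {..<d} \<le> card (dir C ` C)" using C(2) by (intro card_mono) auto
    then show False using card_image_le[OF C(2), of "dir C"] C(3) by simp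
  qed
  then obtain m where m: "m < d" "m \<notin> dir C ` C" by blast
  define a' where "a' = a(v := q C)"
  define s' where "s' = s(v := \<epsilon>/2)"
  \<comment> \<open>If \<open>v \<in> D\<close>, the point lies on the upper facet of the new cube
    in direction \<open>m\<close>, stays on the facets of the other members of \<open>D\<close>, and
    is lifted by \<epsilon>/4 elsewhere, off the facets of \<open>C - D\<close>; since 1/4 + 1/8
    \<le> 1/2, its box stays above the new cube. The point of \<open>C\<close> moves to 3/4 of
    \<epsilon>, beyond the range from 1/2 to 5/8 used by those cliques.\<close>
  define q' where "q' D = (if v \<in> D then (\<lambda>j. if j = m then q C m + \<epsilon>/2
        else if j \<in> dir C ` (D - {v}) then q C j else q C j + \<epsilon>/4)
      else if D = C then (q C)(m := q C m + 3/4*\<epsilon>) else q D)" for D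
  \<comment> \<open>\<open>par D\<close> is the old clique whose private cube contains the new
    private cube of \<open>D\<close>.\<close>
  define par where "par D = (if v \<in> D then C else D)" for D
  define dir' where "dir' D u = (if u = v then m else dir (par D) u)" for D u
  let ?G = "add_vertex G v C"
  note e = eps_pos
  have vC: "v \<notin> C" using v cliquesD(1)[OF C(1)] by blast
  have V: "verts ?G = insert v (verts G)" by (simp add: add_vertex_def)
  have par: "par D \<in> cliques G" "D - {v} \<subseteq> par D" if "D \<in> cliques ?G" for D
    using cliques_add_vertexD[OF that C(1) v edges_wf] C(1) by (auto simp: par_def split: if_splits)
  \<comment> \<open>The nesting of private cubes; the tightest case is 3/4 + 1/8 \<le> 1, for
    \<open>C\<close> in direction \<open>m\<close>.\<close>
  have q': "q (par D) i \<le> q' D i \<and> q' D i + \<epsilon>/8 \<le> q (par D) i + \<epsilon>" for D i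
    using e by (auto simp: q'_def par_def)
  have old: "a' u = a u" "s' u = s u" "u \<noteq> v" if "u \<in> verts G" for u
    using that v by (auto simp: a'_def s'_def)
  have new: "a' v = q C" "s' v = \<epsilon>/2" by (auto simp: a'_def s'_def)
  have edge: "{u, w} \<in> edges ?G \<longleftrightarrow> {u, w} \<in> edges G" if "u \<noteq> v" "w \<noteq> v" for u w
    using that by (auto simp: add_vertex_def doubleton_eq_iff)
  have edge_v: "{u, v} \<in> edges ?G \<longleftrightarrow> u \<in> C" if "u \<noteq> v" for u
    using that edges_wf v by (auto simp: add_vertex_def doubleton_eq_iff)
  \<comment> \<open>For \<open>u \<in> C\<close>, the upper facet of \<open>u\<close> meets the
    lower facet of the new cube in direction \<open>dir C u\<close>; any other vertex misses the
    whole private cube of \<open>C\<close>.\<close>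
  have novl: "\<exists>i<d. a u i + s u \<le> q C i \<or> q C i + \<epsilon>/2 \<le> a u i" if u: "u \<in> verts G" for u
  proof (cases "u \<in> C")
    case True
    then show ?thesis using point_facet[OF C(1) True] dir_less[OF C(1) True] by (intro exI[of _ "dir C u"]) auto
  next
    case False
    then show ?thesis using point_off[OF C(1) u False] e by force
  qed
  have touch: "u \<in> C \<longleftrightarrow> (\<forall>i<d. a u i \<le> q C i + \<epsilon>/2 \<and> q C i \<le> a u i + s u)"
    if u: "u \<in> verts G" for u
  proof
    assume uC: "u \<in> C"
    show "\<forall>i<d. a u i \<le> q C i + \<epsilon>/2 \<and> q C i \<le> a u i + s u"
    proof (intro allI impI)
      fix i assume "i < d"
      then show "a u i \<le> q C i + \<epsilon>/2 \<and> q C i \<le> a u i + s u"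
        using point_facet[OF C(1) uC] point_side[OF C(1) uC, of i] side_pos[OF u] e
        by (cases "i = dir C u") auto
    qed
  next
    assume *: "\<forall>i<d. a u i \<le> q C i + \<epsilon>/2 \<and> q C i \<le> a u i + s u"
    show "u \<in> C"
    proof (rule ccontr)
      assume "u \<notin> C"
      from point_off[OF C(1) u this] obtain i where "i < d" "q C i + \<epsilon> < a u i \<or> a u i + s u < q C i"
        by blast
      then show False using spec[OF *, of i] e by auto
    qed
  qed
  have "cube_rep d ?G a' s' q' dir' (\<epsilon>/8)"
  proof
    show "\<Union> (edges ?G) \<subseteq> verts ?G"
      using edges_wf cliquesD(1)[OF C(1)] by (auto simp: add_vertex_def)
    show "0 < \<epsilon>/8" using e by simp
  next
    fix u assume "u \<in> verts ?G"
    then show "0 < s' u" using e side_pos old new by (auto simp: V)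
  next
    fix u i assume "u \<in> verts ?G" "i < d"
    then show "0 \<le> a' u i \<and> a' u i + s' u < 1"
      using e cube_in[of u i] point_in[OF C(1), of i] old new by (auto simp: V)
  next
    fix u w assume "u \<in> verts ?G" "w \<in> verts ?G" "u \<noteq> w"
    then consider "u \<in> verts G" "w \<in> verts G" | "u = v" "w \<in> verts G" | "w = v" "u \<in> verts G"
      by (auto simp: V)
    then show "\<exists>i<d. a' u i + s' u \<le> a' w i \<or> a' w i + s' w \<le> a' u i"
    proof cases
      case 1 then show ?thesis using non_overlap \<open>u \<noteq> w\<close> old by simp
    next
      case 2 then show ?thesis using novl[of w] old new by auto
    next
      case 3 then show ?thesis using novl[of u] old new by auto
    qed
  next
    fix u w assume "u \<in> verts ?G" "w \<in> verts ?G" "u \<noteq> w"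
    then consider "u \<in> verts G" "w \<in> verts G" | "u = v" "w \<in> verts G" | "w = v" "u \<in> verts G"
      by (auto simp: V)
    then show "{u, w} \<in> edges ?G \<longleftrightarrow> (\<forall>i<d. a' u i \<le> a' w i + s' w \<and> a' w i \<le> a' u i + s' u)"
    proof cases
      case 1 then show ?thesis using touch_iff \<open>u \<noteq> w\<close> old edge by simp
    next
      case 2
      then have "{u, w} \<in> edges ?G \<longleftrightarrow> w \<in> C" using edge_v[of w] old(3) by (simp add: insert_commute)
      then show ?thesis using 2 touch[of w] old new by auto
    next
      case 3 then show ?thesis using edge_v[of u] touch[of u] old new by auto
    qed
  next
    fix D i assume "D \<in> cliques ?G" "i < d"
    then show "0 \<le> q' D i \<and> q' D i + \<epsilon>/8 < 1"
      using point_in[OF par(1), of D i] q'[of D i] by auto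
  next
    fix D E assume D: "D \<in> cliques ?G" and E: "E \<in> cliques ?G" and "D \<noteq> E"
    show "\<exists>i<d. q' D i + \<epsilon>/8 < q' E i \<or> q' E i + \<epsilon>/8 < q' D i"
    proof (cases "par D = par E")
      case False
      from points_apart[OF par(1)[OF D] par(1)[OF E] False] obtain i where
        "i < d" "q (par D) i + \<epsilon> < q (par E) i \<or> q (par E) i + \<epsilon> < q (par D) i" by blast
      then show ?thesis using q'[of D i] q'[of E i] by (intro exI[of _ i]) auto
    next
      case True
      \<comment> \<open>Distinct cliques with equal parents either both contain \<open>v\<close>, or
        one contains \<open>v\<close> and the other is \<open>C\<close>.\<close>
      then consider "v \<in> D" "E = C" | "v \<in> E" "D = C" | "v \<in> D" "v \<in> E"
        using \<open>D \<noteq> E\<close> by (auto simp: par_def split: if_splits)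
      then show ?thesis
      proof cases
        case 1 then show ?thesis using m e vC by (intro exI[of _ m]) (auto simp: q'_def)
      next
        case 2 then show ?thesis using m e vC by (intro exI[of _ m]) (auto simp: q'_def)
      next
        case 3
        \<comment> \<open>The direction of \<open>u\<close> separates: the point of \<open>A\<close>
          stays on the facet of \<open>u\<close>, while that of \<open>B\<close> is lifted by
          \<epsilon>/4, which exceeds \<epsilon>/8. Injectivity of \<open>dir C\<close> ensures that
          no other vertex of \<open>C\<close> prevents the lift.\<close>
        have sep: "\<exists>i<d. q' A i + \<epsilon>/8 < q' B i"
          if "v \<in> A" "v \<in> B" "u \<in> A" "u \<notin> B" "A - {v} \<subseteq> C" "B - {v} \<subseteq> C" for A B u
        proof -
          have "u \<in> C" using that by auto
          then have "dir C u \<noteq> m" "dir C u < d" using m dir_less[OF C(1)] by auto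
          moreover have "dir C u \<notin> dir C ` (B - {v})"
            using inj_on_image_mem_iff[OF inj_dir[OF C(1)] \<open>u \<in> C\<close> that(6)] that by simp
          moreover have "dir C u \<in> dir C ` (A - {v})" using that by auto
          ultimately show ?thesis
            using that e by (intro exI[of _ "dir C u"]) (auto simp: q'_def)
        qed
        have sub: "D - {v} \<subseteq> C" "E - {v} \<subseteq> C" using par(2)[OF D] par(2)[OF E] 3 by (auto simp: par_def)
        obtain u where "u \<in> D \<and> u \<notin> E \<or> u \<in> E \<and> u \<notin> D" using \<open>D \<noteq> E\<close> by blast
        then show ?thesis using sep[of D E u] sep[of E D u] 3 sub by blast
      qed
    qed
  next
    fix D w assume D: "D \<in> cliques ?G" and w: "w \<in> verts ?G" "w \<notin> D"
    consider "w = v" "D = C" | "w = v" "D \<noteq> C" | "w \<in> verts G" "w \<notin> par D"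
      | "w \<in> verts G" "w \<in> par D"
      using w by (auto simp: V)
    then show "\<exists>i<d. q' D i + \<epsilon>/8 < a' w i \<or> a' w i + s' w < q' D i"
    proof cases
      case 1 then show ?thesis using m e vC new by (intro exI[of _ m]) (auto simp: q'_def)
    next
      case 2
      \<comment> \<open>The new cube lies in the old private cube of \<open>C\<close>, which was
        already apart from that of \<open>D\<close>.\<close>
      then have "par D = D" using w by (simp add: par_def)
      then obtain i where i: "i < d" "q D i + \<epsilon> < q C i \<or> q C i + \<epsilon> < q D i"
        using points_apart[of D C] par(1)[OF D] C(1) 2 by auto
      have "q D i \<le> q' D i \<and> q' D i + \<epsilon>/8 \<le> q D i + \<epsilon>"
        using q'[of D i] unfolding \<open>par D = D\<close> .
      then have "q' D i + \<epsilon>/8 < q C i \<or> q C i + \<epsilon>/2 < q' D i" using i(2) e by linarith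
      then show ?thesis unfolding 2(1) new using i(1) by blast
    next
      case 3
      from point_off[OF par(1)[OF D] this] obtain i where
        "i < d" "q (par D) i + \<epsilon> < a w i \<or> a w i + s w < q (par D) i" by blast
      then show ?thesis using q'[of D i] 3 old by (intro exI[of _ i]) auto
    next
      case 4
      \<comment> \<open>Here \<open>D\<close> passes through \<open>v\<close> and omits
        \<open>w\<close> from \<open>C\<close>, so its point is lifted by \<epsilon>/4 off the facet
        of \<open>w\<close>.\<close>
      then have vD: "v \<in> D" "w \<in> C" using w by (auto simp: par_def split: if_splits)
      then have "dir C w \<noteq> m" "dir C w < d" using m dir_less[OF C(1)] by auto
      moreover have "dir C w \<notin> dir C ` (D - {v})"
        using inj_on_image_mem_iff[OF inj_dir[OF C(1)] \<open>w \<in> C\<close>, of "D - {v}"] par(2)[OF D] vD w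
        by (auto simp: par_def)
      ultimately show ?thesis
        using vD e point_facet[OF C(1) vD(2)] old 4 by (intro exI[of _ "dir C w"]) (auto simp: q'_def)
    qed
  next
    fix D w assume "D \<in> cliques ?G" "w \<in> D"
    then show "dir' D w < d" using m par[of D] dir_less[of "par D" w] by (auto simp: dir'_def)
  next
    fix D w assume D: "D \<in> cliques ?G" and w: "w \<in> D"
    show "q' D (dir' D w) = a' w (dir' D w) + s' w"
    proof (cases "w = v")
      case True then show ?thesis using w new by (simp add: dir'_def q'_def)
    next
      case False
      then have wp: "w \<in> par D" using par(2)[OF D] w by blast
      then have "a' w = a w" "s' w = s w" using old cliquesD(1)[OF par(1)[OF D]] by auto
      \<comment> \<open>Neither the shift in direction \<open>m\<close> nor the \<epsilon>/4 lift
        touches the direction of an old member of \<open>D\<close>.\<close>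
      moreover have "q' D (dir (par D) w) = q (par D) (dir (par D) w)"
        using w wp m False by (auto simp: q'_def par_def)
      ultimately show ?thesis using False point_facet[OF par(1)[OF D] wp] by (simp add: dir'_def)
    qed
  next
    fix D w i assume D: "D \<in> cliques ?G" and w: "w \<in> D" and i: "i < d" "i \<noteq> dir' D w"
    show "a' w i \<le> q' D i \<and> q' D i + \<epsilon>/8 \<le> a' w i + s' w"
    proof (cases "w = v")
      case True then show ?thesis using w i new e by (auto simp: dir'_def q'_def)
    next
      case False
      then have wp: "w \<in> par D" using par(2)[OF D] w by blast
      then have "a' w = a w" "s' w = s w" using old cliquesD(1)[OF par(1)[OF D]] by auto
      then show ?thesis
        using q'[of D i] point_side[OF par(1)[OF D] wp, of i] i False by (auto simp: dir'_def)
    qed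
  next
    fix D assume D: "D \<in> cliques ?G"
    have "inj_on (dir (par D)) (D - {v})"
      using inj_on_subset[OF inj_dir[OF par(1)[OF D]] par(2)[OF D]] .
    moreover have "m \<notin> dir (par D) ` (D - {v})" if "v \<in> D"
      using m(2) par(2)[OF D] that by (auto simp: par_def)
    ultimately show "inj_on (dir' D) D"
      by (fastforce simp: inj_on_def dir'_def)
  qed
  then show ?thesis by blast
qed

end

text \<open>Neighbourhoods have at most \<open>k\<close> vertices, so dimension \<open>k + 1\<close>
  always leaves the free direction that an addition needs.\<close>

lemma grows_imp_cube_rep:
  assumes "grows k (complete_sgraph {}) G"
  shows "\<exists>a s q dir \<epsilon>. cube_rep (k + 1) G a s q dir \<epsilon>"
  using assms
proof (induction rule: grows.induct)
  case refl
  show ?case by (intro exI) (rule cube_rep_empty, simp)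
next
  case (add G C v)
  then obtain a s q dir \<epsilon> where "cube_rep (k + 1) G a s q dir \<epsilon>" by blast
  then show ?case using add.hyps by (intro cube_rep.cube_rep_add_vertex) auto
qed

section \<open>From cubes to clique-sum extendable representations\<close>

lemma closed_box_Int_nonempty_iff:
  assumes "\<And>i. i < d \<Longrightarrow> a i \<le> b i" "\<And>i. i < d \<Longrightarrow> a' i \<le> b' i"
  shows "closed_box d a b \<inter> closed_box d a' b' \<noteq> {} \<longleftrightarrow> (\<forall>i<d. a i \<le> b' i \<and> a' i \<le> b i)"
    (is "?L \<longleftrightarrow> ?R")
proof
  assume ?L
  then show ?R by (force simp: closed_box_def)
next
  assume ?R
  \<comment> \<open>The common point is the coordinatewise maximum of the lowest corners, set to 0
    from index \<open>d\<close> on as membership in \<open>Euclidean_space d\<close>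
    demands.\<close>
  then have "(\<lambda>i. if i < d then max (a i) (a' i) else 0) \<in> closed_box d a b \<inter> closed_box d a' b'"
    using assms by (auto simp: closed_box_def topspace_Euclidean_space)
  then show ?L by blast
qed

lemma coord_closed_box:
  assumes "\<And>i. i < d \<Longrightarrow> a i \<le> b i" "j < d"
  shows "coord (closed_box d a b) j = {a j..b j}"
proof
  show "coord (closed_box d a b) j \<subseteq> {a j..b j}"
    using assms(2) by (auto simp: coord_def closed_box_def)
  show "{a j..b j} \<subseteq> coord (closed_box d a b) j"
  proof
    fix t assume "t \<in> {a j..b j}"
    then have "(\<lambda>i. if i < d then (if i = j then t else a i) else 0) \<in> closed_box d a b"
      using assms by (auto simp: closed_box_def topspace_Euclidean_space)
    then show "t \<in> coord (closed_box d a b) j"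
      using assms(2) unfolding coord_def by (rule_tac image_eqI) auto
  qed
qed

text \<open>Moving only coordinate \<open>i\<close> of \<open>x\<close> is a continuous map from the
  reals, so the preimage of an open neighbourhood inside the box contains a ball around
  \<open>x i\<close>. Half its radius can be gone in both directions.\<close>

lemma interior_of_closed_boxD:
  assumes x: "x \<in> Euclidean_space d interior_of closed_box d a b" and i: "i < d"
  shows "a i < x i \<and> x i < b i"
proof -
  obtain U where U: "openin (Euclidean_space d) U" "x \<in> U" "U \<subseteq> closed_box d a b"
    using x by (auto simp: interior_of_def)
  let ?g = "\<lambda>t j. if j < d then (if j = i then t else x j) else 0"
  have "continuous_map euclideanreal (Euclidean_space d) ?g"
    unfolding continuous_map_componentwise_Euclidean_space by (auto intro: continuous_intros)
  then have "open {t. ?g t \<in> U}"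
    using openin_continuous_map_preimage[OF _ U(1), of euclideanreal ?g] by simp
  moreover have "?g (x i) = x"
    using U(2) openin_subset[OF U(1)] by (fastforce simp: topspace_Euclidean_space)
  ultimately obtain r where r: "r > 0" "ball (x i) r \<subseteq> {t. ?g t \<in> U}"
    using U(2) openE[of "{t. ?g t \<in> U}" "x i"] by auto
  have "a i \<le> t \<and> t \<le> b i" if "t \<in> ball (x i) r" for t
  proof -
    have "?g t \<in> closed_box d a b" using r(2) U(3) that by blast
    then show ?thesis using i by (auto simp: closed_box_def dest!: spec[of _ i])
  qed
  from this[of "x i - r/2"] this[of "x i + r/2"] show ?thesis using r(1) by (auto simp: dist_real_def)
qed

section \<open>The hypercubes as an extendable touching representation\<close>

context cube_rep
begin

definition h :: "'a \<Rightarrow> (nat \<Rightarrow> real) set" where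
  "h v = closed_box d (a v) (\<lambda>i. a v i + s v)"

lemma touching_rep_h: "touching_rep d G h"
  unfolding touching_rep_def
proof (intro conjI ballI impI)
  fix v assume "v \<in> verts G"
  then show "is_box d (h v)"
    using side_pos unfolding is_box_def h_def
    by (intro exI[of _ "a v"] exI[of _ "\<lambda>i. a v i + s v"]) auto
next
  fix u v assume uv: "u \<in> verts G" "v \<in> verts G" "u \<noteq> v"
  obtain i where i: "i < d" "a u i + s u \<le> a v i \<or> a v i + s v \<le> a u i"
    using non_overlap[OF uv] by blast
  show "Euclidean_space d interior_of h u \<inter> Euclidean_space d interior_of h v = {}"
  proof (rule equals0I)
    fix x assume "x \<in> Euclidean_space d interior_of h u \<inter> Euclidean_space d interior_of h v"
    then have "a u i < x i \<and> x i < a u i + s u" "a v i < x i \<and> x i < a v i + s v"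
      using interior_of_closed_boxD[OF _ i(1)] unfolding h_def by auto
    then show False using i(2) by linarith
  qed
  show "h u \<inter> h v \<noteq> {} \<longleftrightarrow> {u, v} \<in> edges G"
    unfolding h_def using side_pos uv touch_iff[OF uv]
    by (subst closed_box_Int_nonempty_iff) (auto simp: less_imp_le)
qed

text \<open>Cubes are linearly ordered by side length: aligning the lowest corners puts the smaller
  one into the larger.\<close>

lemma by_comparable_boxes_h: "by_comparable_boxes d G h"
proof -
  have "box_le d (h u) (h v)" if "s u \<le> s v" for u v
    unfolding box_le_def
    by (rule bexI[of _ "\<lambda>i. if i < d then a v i - a u i else 0"])
      (use that in \<open>auto simp: h_def closed_box_def topspace_Euclidean_space\<close>)
  then show ?thesis
    unfolding by_comparable_boxes_def comparable_def by (meson linear)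
qed

lemma cliques_condition_h:
  assumes \<delta>: "0 < \<delta>" "\<delta> \<le> \<epsilon>"
  shows "cliques_condition d G h \<delta>"
proof -
  \<comment> \<open>\<open>q C\<close> is unconstrained from index \<open>d\<close> on, whereas
    points of \<open>Euclidean_space d\<close> vanish there.\<close>
  define p where "p C = (\<lambda>i. if i < d then q C i else 0)" for C
  have eb: "eps_box d \<delta> (p C) = closed_box d (q C) (\<lambda>i. q C i + \<delta>)" for C
    by (auto simp: eps_box_def closed_box_def p_def)
  have cube: "p C \<in> unit_cube d" if "C \<in> cliques G" for C
    using point_in[OF that] eps_pos by (force simp: p_def unit_cube_def topspace_Euclidean_space)
  have mem: "p C \<in> h v" if C: "C \<in> cliques G" "v \<in> C" for C v
  proof -
    have "0 < s v" using side_pos cliquesD(1)[OF C(1)] C(2) by blast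
    then have "a v i \<le> q C i \<and> q C i \<le> a v i + s v" if "i < d" for i
      using point_facet[OF C] point_side[OF C that] eps_pos by (cases "i = dir C v") auto
    then show ?thesis by (auto simp: p_def h_def closed_box_def topspace_Euclidean_space)
  qed
  have apart: "eps_box d \<delta> (p C) \<inter> eps_box d \<delta> (p D) = {}"
    if "C \<in> cliques G" "D \<in> cliques G" "C \<noteq> D" for C D
    using points_apart[OF that] \<delta> closed_box_Int_nonempty_iff[of d "q C" "\<lambda>i. q C i + \<delta>" "q D" "\<lambda>i. q D i + \<delta>"]
    unfolding eb by force
  have off: "h v \<inter> eps_box d \<delta> (p C) = {}"
    if "C \<in> cliques G" "v \<in> verts G" "v \<notin> C" for C v
    using point_off[OF that] \<delta> side_pos[OF that(2)]
      closed_box_Int_nonempty_iff[of d "a v" "\<lambda>i. a v i + s v" "q C" "\<lambda>i. q C i + \<delta>"]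
    unfolding eb h_def by force
  have meet: "h v \<inter> eps_box d \<delta> (p C) \<noteq> {}" if "p C \<in> h v" for C v
  proof -
    have "p C \<in> eps_box d \<delta> (p C)"
      using \<delta> by (auto simp: eps_box_def closed_box_def p_def topspace_Euclidean_space)
    then show ?thesis using that by blast
  qed
  \<comment> \<open>In direction \<open>dir C v\<close> the small box starts exactly where
    \<open>h v\<close> ends, so they share one value; in the other directions its interval lies
    inside that of \<open>h v\<close>.\<close>
  have facet: "\<exists>i<d. \<forall>j<d. coord (h v) j \<inter> coord (eps_box d \<delta> (p C)) j =
      (if j = i then {p C i} else {p C j..p C j + \<delta>})" if C: "C \<in> cliques G" "v \<in> C" for C v
  proof (intro exI[of _ "dir C v"] conjI allI impI)
    show "dir C v < d" using dir_less[OF C] .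
    fix j assume j: "j < d"
    have sv: "0 < s v" using side_pos cliquesD(1)[OF C(1)] C(2) by blast
    have "coord (h v) j = {a v j..a v j + s v}"
      unfolding h_def using sv j by (subst coord_closed_box) auto
    moreover have "coord (eps_box d \<delta> (p C)) j = {q C j..q C j + \<delta>}"
      unfolding eb using \<delta> j by (subst coord_closed_box) auto
    ultimately show "coord (h v) j \<inter> coord (eps_box d \<delta> (p C)) j =
      (if j = dir C v then {p C (dir C v)} else {p C j..p C j + \<delta>})"
      using point_facet[OF C] point_side[OF C j] \<delta> j sv by (auto simp: p_def)
  qed
  show ?thesis
    unfolding cliques_condition_def
    by (intro exI[of _ p] conjI ballI impI iffI cube mem apart facet meet)
      (use off in blast)+
qed

text \<open>Every positive value below the \<epsilon> of the locale is small enough. With no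
  distinguished vertices, the vertices condition asks only for the half-open unit cube, where the
  strict bound in \<open>cube_in\<close> places every \<open>h v\<close>.\<close>

lemma clique_sum_extendable_h: "clique_sum_extendable d G {} h"
proof -
  have "vertices_condition d G {} h"
    using cube_in unfolding vertices_condition_def
    by (force simp: h_def closed_box_def unit_cube_def)
  moreover have "\<forall>\<^sub>F \<delta> in at_right 0. \<delta> \<in> {0<..<\<epsilon>}"
    using eps_pos by (rule eventually_at_right_real)
  then have "\<forall>\<^sub>F \<delta> in at_right 0. cliques_condition d G h \<delta>"
    by eventually_elim (auto intro: cliques_condition_h)
  moreover have "{} \<in> cliques G" by (rule cliquesI) auto
  ultimately show ?thesis
    by (simp add: clique_sum_extendable_def touching_rep_h)
qed

end

theorem theorem17:
  fixes k :: nat and G :: "'a sgraph"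
  assumes "k_tree k G"
  shows "dim_cb G \<le> dim_cb_ext G \<and> dim_cb_ext G \<le> enat (k + 1)"
proof
  \<comment> \<open>An extendable representation is in particular a touching one, so the right-hand
    infimum ranges over a subset of the dimensions on the left.\<close>
  show "dim_cb G \<le> dim_cb_ext G"
    unfolding dim_cb_def dim_cb_ext_def
    by (rule Inf_superset_mono) (auto simp: clique_sum_extendable_def)
  have "{} \<in> cliques G" by (rule cliquesI) auto
  then obtain a s q dir \<epsilon> where "cube_rep (k + 1) G a s q dir \<epsilon>"
    using grows_imp_cube_rep k_tree_grows[OF assms] by blast
  then interpret cube_rep "k + 1" G a s q dir \<epsilon> .
  show "dim_cb_ext G \<le> enat (k + 1)"
    unfolding dim_cb_ext_def
    by (rule Inf_lower) (use clique_sum_extendable_h by_comparable_boxes_h in blast)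
qed

end
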